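(* Let $m\ge 0$, $p\ge 2m+1$ be integers, $\Delta=[M-h/2,M+h/2]$ with $h>0$, and let $u\in C^\infty(\Delta)$. Let $s\ge 0$ be an integer and $v(x)=\sum_{i=0}^{p+s+1}\frac{(x-M)^i}{i!}u^{(i)}(M)$. Then for every $x\in(M-h/2,M+h/2)$ there exists $\hat x\in\Delta$ such that $$\begin{aligned}u(x)-W_{p,\Delta}^m(x)=\;&\Upsilon_{p+1,\Delta}^m(x)\sum_{i=0}^{s}\frac{u^{(p+i+1)}(M)}{(p+i+1)!}\Psi_{i,\Delta}^m(x)+\frac{u^{(p+s+2)}(\hat x)}{(p+s+2)!}(x-M)^{p+s+2}\\&+\sum_{i=2}^{p-2m}\big(v(M_i)-u(M_i)\big)\hat L_{i,\Delta}^{m,p}(x)+\sum_{l=0}^{m}\big(v^{(l)}(M_1)-u^{(l)}(M_1)\big)\hat A_{l,\Delta}^{m,p}(x)\\&+\sum_{l=0}^{m}\big(v^{(l)}(M_{p-2m+1})-u^{(l)}(M_{p-2m+1})\big)\hat B_{l,\Delta}^{m,p}(x),\end{aligned}$$ where, for $i=0,1,\ldots,s$, $$\Psi_{i,\Delta}^m(x)=\frac{(x-M)^{p+i+1}-\pi^\Delta (x-M)^{p+i+1}}{\Upsilon_{p+1,\Delta}^m(x)}=\sum_{l=0}^{\lfloor i/2\rfloor}a_{i-2l}^{i,m}(x-M)^{i-2l},$$ with $a_i^{i,m}=1$ and $$a_{i-2l}^{i,m}=-\sum_{j=1}^{\min(l,\lfloor (p+1)/2\rfloor)}a_{i-2(l-j)}^{i,m}\,\hat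 a_{p+1-2j}^{p+1,m},\qquad l=1,2,\ldots,\lfloor i/2\rfloor .$$
   Context: $P_n$ is the Legendre polynomial of degree $n$. For integers $n\ge -1$, $r\ge 2n+2$ let $J_{n,r}=\frac{2^{r-n-2}(r-n-2)!(r-2n-2)!}{(2r-2n-3)!}$ (with $J_{-1,0}=1$) and $\mathcal{J}_r^n(\mu)=J_{n,r}(\mu^2-1)^{n+1}P_{r-n-1}^{(n+1)}(\mu)=(\mu^2-1)^{n+1}\mathcal{J}_{r-2n-2}^{-n-2}(\mu)$, where $\mathcal{J}_q^{-n-2}(\mu)=J_{n,q+2n+2}P_{q+n+1}^{(n+1)}(\mu)$; these are monic polynomials. Interpolation points: let $\mu_2<\cdots<\mu_{p-2m}$ be the $p-2m-1$ roots of $\mathcal{J}_{p-2m-1}^{-m-2}$ (real, simple, in $(-1,1)$); $M_i=M+h\mu_i/2$ for $i=2,\ldots,p-2m$, $M_1=M-h/2$, $M_{p-2m+1}=M+h/2$ (no interior points if $p=2m+1$). $\Upsilon_{p+1,\Delta}^m(x)=(h/2)^{p+1}\mathcal{J}_{p+1}^m(2(x-M)/h)=\sum_{i=0}^{\lfloor (p+1)/2\rfloor}\hat a_{p+1-2i}^{p+1,m}(x-M)^{p+1-2i}$, which defines the $\hat a$'s ($\hat a_{p+1}^{p+1,m}=1$). The Hermite-Jacobi interpolant $W_{p,\Delta}^m$ of $u$ is the polynomial of degree at most $p$ with $(W_{p,\Delta}^m)^{(i)}(M\pm h/2)=u^{(i)}(M\pm h/2)$, $i=0,\ldots,m$, and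 $W_{p,\Delta}^m(M_i)=u(M_i)$, $i=2,\ldots,p-2m$. $\pi^\Delta$ is the linear operator sending a $C^\infty(\Delta)$ function to its Hermite-Jacobi interpolant. For $i=2,\ldots,p-2m$: $$\hat L_{i,\Delta}^{m,p}(x)=\frac{(x-M_1)^{m+1}}{(M_i-M_1)^{m+1}}\,\frac{(x-M_{p-2m+1})^{m+1}}{(M_i-M_{p-2m+1})^{m+1}}\prod_{j=2,\,j\ne i}^{p-2m}\frac{x-M_j}{M_i-M_j}.$$ For $l=0,\ldots,m$: $$\hat A_{l,\Delta}^{m,p}(x)=\frac{\sum_{j=0}^{m-l}A_{j,l}(x-M_1)^{j+l}}{l!}\cdot\frac{(x-M_{p-2m+1})^{m+1}\prod_{j=2}^{p-2m}(x-M_j)}{(M_1-M_{p-2m+1})^{m+1}\prod_{j=2}^{p-2m}(M_1-M_j)},$$ $$\hat B_{l,\Delta}^{m,p}(x)=\frac{\sum_{j=0}^{m-l}B_{j,l}(x-M_{p-2m+1})^{j+l}}{l!}\cdot\frac{(x-M_1)^{m+1}\prod_{j=2}^{p-2m}(x-M_j)}{(M_{p-2m+1}-M_1)^{m+1}\prod_{j=2}^{p-2m}(M_{p-2m+1}-M_j)},$$ where the constants $A_{j,l},B_{j,l}$ are determined by requiring $(\hat A_{l,\Delta}^{m,p})^{(k)}(M_1)=\delta_{kl}$ and $(\hat B_{l,\Delta}^{m,p})^{(k)}(M_{p-2m+1})=\delta_{kl}$ for $k=0,\ldots,m$. *)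

theory Defs
  imports "HOL-Analysis.Analysis" "HOL-Computational_Algebra.Polynomial"
begin

text \<open>Iterated derivatives relative to \<^term>\<open>S\<close>, so that on a closed interval the derivatives at the
  endpoints are one-sided and no values outside \<^term>\<open>S\<close> matter.\<close>

primrec nderiv_within :: "real set \<Rightarrow> (real \<Rightarrow> real) \<Rightarrow> nat \<Rightarrow> real \<Rightarrow> real" where
  "nderiv_within S u 0 = u"
| "nderiv_within S u (Suc n) = (\<lambda>x. vector_derivative (nderiv_within S u n) (at x within S))"

definition C_infinity_on :: "real set \<Rightarrow> (real \<Rightarrow> real) \<Rightarrow> bool" where
  "C_infinity_on S u \<longleftrightarrow> (\<forall>n. nderiv_within S u n differentiable_on S)"

text \<open>Rodrigues' formula.\<close>

definition legendre_poly :: "nat \<Rightarrow> real poly" where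
  "legendre_poly n = smult (1 / (2 ^ n * fact n)) ((pderiv ^^ n) ([:-1, 0, 1:] ^ n))"

text \<open>The polynomials \<open>\<J>\<^sub>r\<^sup>n\<close> and \<open>\<J>\<^sub>q\<^sup>-\<^sup>n\<^sup>-\<^sup>2\<close> are used only for
  \<open>n \<ge> 0\<close> and \<open>r \<ge> 2n + 2\<close>, where all truncated subtractions below are exact.\<close>

definition jacobi_const :: "nat \<Rightarrow> nat \<Rightarrow> real" where
  "jacobi_const n r =
     2 ^ (r - n - 2) * fact (r - n - 2) * fact (r - 2 * n - 2) / fact (2 * r - 2 * n - 3)"

definition jacobi_poly :: "nat \<Rightarrow> nat \<Rightarrow> real poly" where
  "jacobi_poly n r = smult (jacobi_const n r)
     ([:-1, 0, 1:] ^ (n + 1) * (pderiv ^^ (n + 1)) (legendre_poly (r - n - 1)))"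

definition jacobi_neg_poly :: "nat \<Rightarrow> nat \<Rightarrow> real poly" where
  "jacobi_neg_poly n q = smult (jacobi_const n (q + 2 * n + 2))
     ((pderiv ^^ (n + 1)) (legendre_poly (q + n + 1)))"

text \<open>\<open>\<mu>\<^sub>2 < \<dots> < \<mu>\<^bsub>p-2m\<^esub>\<close>: the real roots in increasing order, numbered from 2.\<close>

definition jacobi_root :: "nat \<Rightarrow> nat \<Rightarrow> nat \<Rightarrow> real" where
  "jacobi_root m p i =
     sorted_list_of_set {\<mu>. poly (jacobi_neg_poly m (p - 2 * m - 1)) \<mu> = 0} ! (i - 2)"

definition node :: "nat \<Rightarrow> nat \<Rightarrow> real \<Rightarrow> real \<Rightarrow> nat \<Rightarrow> real" where
  "node m p M h i =
     (if i = 1 then M - h / 2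
      else if i = p - 2 * m + 1 then M + h / 2
      else M + h * jacobi_root m p i / 2)"

text \<open>\<open>Upsilon_centred\<close> is \<open>\<Upsilon>\<close> as a polynomial in \<open>y = x - M\<close>, so that its coefficients are
  the numbers \<open>\<hat>a\<^sub>k\<^bsup>p+1,m\<^esup>\<close>.\<close>

definition Upsilon_centred :: "nat \<Rightarrow> nat \<Rightarrow> real \<Rightarrow> real poly" where
  "Upsilon_centred m p h =
     smult ((h / 2) ^ (p + 1)) (pcompose (jacobi_poly m (p + 1)) [:0, 2 / h:])"

definition Upsilon :: "nat \<Rightarrow> nat \<Rightarrow> real \<Rightarrow> real \<Rightarrow> real poly" where
  "Upsilon m p M h = pcompose (Upsilon_centred m p h) [:-M, 1:]"

definition a_hat :: "nat \<Rightarrow> nat \<Rightarrow> real \<Rightarrow> nat \<Rightarrow> real" where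
  "a_hat m p h k = coeff (Upsilon_centred m p h) k"

definition hermite_jacobi :: "nat \<Rightarrow> nat \<Rightarrow> real \<Rightarrow> real \<Rightarrow> (real \<Rightarrow> real) \<Rightarrow> real poly" where
  "hermite_jacobi m p M h u = (THE W. degree W \<le> p
     \<and> (\<forall>i\<le>m.
          poly ((pderiv ^^ i) W) (M - h / 2)
            = nderiv_within {M - h / 2..M + h / 2} u i (M - h / 2)
        \<and> poly ((pderiv ^^ i) W) (M + h / 2)
            = nderiv_within {M - h / 2..M + h / 2} u i (M + h / 2))
     \<and> (\<forall>i\<in>{2..p - 2 * m}. poly W (node m p M h i) = u (node m p M h i)))"

definition L_hat :: "nat \<Rightarrow> nat \<Rightarrow> real \<Rightarrow> real \<Rightarrow> nat \<Rightarrow> real poly" where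
  "L_hat m p M h i =
     (let x = node m p M h; e = p - 2 * m + 1 in
       smult (1 / (x i - x 1) ^ (m + 1)) ([:- x 1, 1:] ^ (m + 1))
     * smult (1 / (x i - x e) ^ (m + 1)) ([:- x e, 1:] ^ (m + 1))
     * (\<Prod>j\<in>{2..p - 2 * m} - {i}. smult (1 / (x i - x j)) [:- x j, 1:]))"

text \<open>The common shape of \<open>\<hat>A\<^sub>l\<close> and \<open>\<hat>B\<^sub>l\<close>: \<open>b\<close> is the endpoint at which the derivative
  conditions are imposed, \<open>b'\<close> the opposite endpoint, and \<open>c j\<close> stands for
  \<open>A\<^bsub>j,l\<^esub>\<close> or \<open>B\<^bsub>j,l\<^esub>\<close>. The predicate fixes the coefficients outside
  \<open>0 \<le> j \<le> m - l\<close> to be zero only to make the family unique as a function on the naturals.\<close>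

definition end_basis ::
  "nat \<Rightarrow> nat \<Rightarrow> real \<Rightarrow> real \<Rightarrow> real \<Rightarrow> real \<Rightarrow> (nat \<Rightarrow> real) \<Rightarrow> nat \<Rightarrow> real poly" where
  "end_basis m p M h b b' c l =
     smult (1 / fact l) (\<Sum>j\<le>m - l. smult (c j) ([:- b, 1:] ^ (j + l)))
   * smult (1 / ((b - b') ^ (m + 1) * (\<Prod>j\<in>{2..p - 2 * m}. b - node m p M h j)))
       ([:- b', 1:] ^ (m + 1) * (\<Prod>j\<in>{2..p - 2 * m}. [:- node m p M h j, 1:]))"

definition end_coeffs ::
  "nat \<Rightarrow> nat \<Rightarrow> real \<Rightarrow> real \<Rightarrow> real \<Rightarrow> real \<Rightarrow> nat \<Rightarrow> nat \<Rightarrow> real" where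
  "end_coeffs m p M h b b' l = (THE c. (\<forall>j>m - l. c j = 0)
     \<and> (\<forall>k\<le>m. poly ((pderiv ^^ k) (end_basis m p M h b b' c l)) b = (if k = l then 1 else 0)))"

definition A_hat :: "nat \<Rightarrow> nat \<Rightarrow> real \<Rightarrow> real \<Rightarrow> nat \<Rightarrow> real poly" where
  "A_hat m p M h l =
     (let x1 = node m p M h 1; xe = node m p M h (p - 2 * m + 1)
      in end_basis m p M h x1 xe (end_coeffs m p M h x1 xe l) l)"

definition B_hat :: "nat \<Rightarrow> nat \<Rightarrow> real \<Rightarrow> real \<Rightarrow> nat \<Rightarrow> real poly" where
  "B_hat m p M h l =
     (let x1 = node m p M h 1; xe = node m p M h (p - 2 * m + 1)
      in end_basis m p M h xe x1 (end_coeffs m p M h xe x1 l) l)"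

definition taylor_poly :: "real set \<Rightarrow> (real \<Rightarrow> real) \<Rightarrow> real \<Rightarrow> nat \<Rightarrow> real poly" where
  "taylor_poly S u M N = (\<Sum>i\<le>N. smult (nderiv_within S u i M / fact i) ([:-M, 1:] ^ i))"

text \<open>\<open>psi_coeff m p h i l\<close> is the coefficient \<open>a\<^bsub>i-2l\<^esub>\<^bsup>i,m\<^esup>\<close>: the last argument is \<open>l\<close>, not
  the subscript.\<close>

function psi_coeff :: "nat \<Rightarrow> nat \<Rightarrow> real \<Rightarrow> nat \<Rightarrow> nat \<Rightarrow> real" where
  "psi_coeff m p h i l =
     (if l = 0 then 1
      else - (\<Sum>j\<in>{1..min l ((p + 1) div 2)}. psi_coeff m p h i (l - j) * a_hat m p h (p + 1 - 2 * j)))"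
  by auto
termination by (relation "Wellfounded.measure (\<lambda>(m, p, h, i, l). l)") auto
declare psi_coeff.simps [simp del]

definition Psi_numerator :: "nat \<Rightarrow> nat \<Rightarrow> real \<Rightarrow> real \<Rightarrow> nat \<Rightarrow> real poly" where
  "Psi_numerator m p M h i =
     [:-M, 1:] ^ (p + i + 1) - hermite_jacobi m p M h (\<lambda>x. (x - M) ^ (p + i + 1))"

text \<open>The quotient is one of polynomials, which gives \<open>\<Psi>\<^sub>i\<close> a value also at the zeros of
  \<open>\<Upsilon>\<close>; \<open>div\<close> truncates unless \<open>\<Upsilon>\<close> divides the numerator.\<close>

definition Psi :: "nat \<Rightarrow> nat \<Rightarrow> real \<Rightarrow> real \<Rightarrow> nat \<Rightarrow> real poly" where
  "Psi m p M h i = Psi_numerator m p M h i div Upsilon m p M h"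

end

theory Submission
  imports Defs
begin

text \<open>
  Since \<open>\<Upsilon>\<close> is the monic polynomial vanishing to order \<open>m + 1\<close> at both endpoints and simply at the
  interior nodes, a polynomial has zero interpolation data iff \<open>\<Upsilon>\<close> divides it. Hence the interpolant of
  a polynomial is its remainder modulo \<open>\<Upsilon>\<close>, and \<open>\<Psi>\<^sub>i\<close> is the quotient of \<open>(x - M)\<^bsup>p+i+1\<^esup>\<close> by
  \<open>\<Upsilon>\<close>, whose coefficients are given by long division. Splitting
  \<open>u - W = (u - v) + (v - \<pi> v) + (\<pi> v - W)\<close>, Taylor's theorem gives the first term, the quotients
  \<open>\<Psi>\<^sub>i\<close> the second, and the Lagrange basis of the interpolation problem the third.
\<close>

section \<open>Zeros of derivatives of Legendre polynomials\<close>

lemma pcompose_power: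
  fixes p :: "real poly"
  shows "pcompose (p ^ n) q = pcompose p q ^ n"
  by (induction n) (simp_all add: pcompose_mult pcompose_1)

lemma higher_pderiv_pcompose_shift:
  fixes p :: "real poly"
  shows "(pderiv ^^ k) (pcompose p [:b, 1:]) = pcompose ((pderiv ^^ k) p) [:b, 1:]"
  by (induction k) (simp_all add: pderiv_pcompose pderiv_pCons)

text \<open>Translating \<open>b\<close> to 0 makes the coefficients of the polynomial its Taylor
  coefficients at \<open>b\<close>. Conditions on derivatives thereby become conditions on
  coefficients.\<close>

lemma poly_higher_pderiv_eq_coeff_shift:
  fixes p :: "real poly"
  shows "poly ((pderiv ^^ k) p) b = fact k * coeff (pcompose p [:b, 1:]) k"
proof -
  have "poly ((pderiv ^^ k) p) b = coeff ((pderiv ^^ k) (pcompose p [:b, 1:])) 0"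
    by (simp add: higher_pderiv_pcompose_shift poly_pcompose flip: poly_0_coeff_0)
  also have "\<dots> = fact k * coeff (pcompose p [:b, 1:]) k"
    by (simp add: coeff_higher_pderiv pochhammer_fact)
  finally show ?thesis .
qed

text \<open>After translation of \<open>b\<close> to 0 the divisor is a monomial, and divisibility
  by \<open>monom 1 n\<close> means that the first \<open>n\<close> coefficients vanish. Endpoint
  conditions of Hermite type are handled throughout as divisibility through this
  equivalence.\<close>

lemma linear_power_dvd_iff_higher_pderiv:
  fixes p :: "real poly"
  shows "[:-b, 1:] ^ n dvd p \<longleftrightarrow> (\<forall>k<n. poly ((pderiv ^^ k) p) b = 0)"
proof -
  have shift: "pcompose (pcompose q [:c, 1:]) [:-c, 1:] = q" for q :: "real poly" and c
    by (simp add: pcompose_pCons flip: pcompose_assoc)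
  have "[:-b, 1:] ^ n dvd p \<longleftrightarrow> monom 1 n dvd pcompose p [:b, 1:]"
  proof
    assume "[:-b, 1:] ^ n dvd p"
    then obtain q where "p = [:-b, 1:] ^ n * q" by (rule dvdE)
    then have "pcompose p [:b, 1:] = monom 1 n * pcompose q [:b, 1:]"
      by (simp add: pcompose_mult pcompose_power pcompose_pCons monom_altdef)
    then show "monom 1 n dvd pcompose p [:b, 1:]" by simp
  next
    assume "monom 1 n dvd pcompose p [:b, 1:]"
    then obtain q where "pcompose p [:b, 1:] = monom 1 n * q" by (rule dvdE)
    then have "pcompose (pcompose p [:b, 1:]) [:-b, 1:] = pcompose (monom 1 n * q) [:-b, 1:]"
      by simp
    then have "p = [:-b, 1:] ^ n * pcompose q [:-b, 1:]"
      by (simp add: shift pcompose_mult pcompose_power pcompose_pCons monom_altdef)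
    then show "[:-b, 1:] ^ n dvd p" by (metis dvd_triv_left)
  qed
  then show ?thesis
    by (simp add: monom_1_dvd_iff' poly_higher_pderiv_eq_coeff_shift)
qed

text \<open>Induction removes the largest root; the mean value theorem on the last gap then supplies
  one further root of the derivative. Confinement strictly between the extreme roots keeps the roots
  inside the open interval when the lemma is iterated.\<close>

lemma rolle_finite_roots:
  fixes p :: "real poly"
  assumes "finite S" "card S = Suc k" "\<And>x. x \<in> S \<Longrightarrow> poly p x = 0"
  shows "\<exists>T. finite T \<and> card T = k \<and> T \<subseteq> {Min S<..<Max S} \<and> (\<forall>x\<in>T. poly (pderiv p) x = 0)"
  using assms
proof (induction k arbitrary: S)
  case 0
  then show ?case by (intro exI[of _ "{}"]) auto
next
  case (Suc k)
  define b where "b = Max S"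
  define S' where "S' = S - {b}"
  have "S \<noteq> {}" using Suc.prems by auto
  then have bS: "b \<in> S" using Suc.prems by (auto simp: b_def)
  have S': "finite S'" "card S' = Suc k" using Suc.prems bS by (auto simp: S'_def)
  then have ne: "S' \<noteq> {}" by auto
  obtain T where T: "finite T" "card T = k" "T \<subseteq> {Min S'<..<Max S'}"
      "\<forall>x\<in>T. poly (pderiv p) x = 0"
    using Suc.IH[of S'] S' Suc.prems by (auto simp: S'_def)
  define a where "a = Max S'"
  have aS: "a \<in> S'" using ne S' by (simp add: a_def)
  have "a \<le> b" using aS Suc.prems by (auto simp: b_def S'_def)
  then have ab: "a < b" using aS by (auto simp: S'_def)
  obtain c where c: "a < c" "c < b" "poly p b - poly p a = (b - a) * poly (pderiv p) c"
    using poly_MVT[OF ab] by blast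
  have "poly p b = 0" "poly p a = 0" using Suc.prems(3) bS aS by (auto simp: S'_def)
  then have c0: "poly (pderiv p) c = 0" using c ab by simp
  have min: "Min S \<le> Min S'"
    using ne Suc.prems by (intro Min_antimono) (auto simp: S'_def)
  have "Min S' \<le> a" using aS S' by simp
  have "c \<notin> T" using T c by (auto simp: a_def)
  then have "card (insert c T) = Suc k" using T by simp
  moreover have "insert c T \<subseteq> {Min S<..<Max S}"
    using T min c ab \<open>Min S' \<le> a\<close> unfolding a_def[symmetric] b_def[symmetric] by force
  ultimately show ?case using T c0 by (intro exI[of _ "insert c T"]) auto
qed

lemma power_dvd_pderiv:
  fixes q p :: "real poly"
  assumes "q ^ Suc k dvd p"
  shows "q ^ k dvd pderiv p"
proof -
  obtain r where "p = q ^ Suc k * r" using assms by (rule dvdE)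
  then have "pderiv p = pderiv (q ^ Suc k * r)" by simp
  also have "\<dots> = q ^ k * (q * pderiv r + r * smult (of_nat (Suc k)) (pderiv q))"
    unfolding pderiv_mult pderiv_power_Suc by (simp add: algebra_simps)
  finally show ?thesis by simp
qed

text \<open>Each differentiation costs at most one power of the factor. Applied to
  \<open>[:-1, 0, 1:] ^ n\<close>, this shows that 1 and -1 remain roots of all derivatives of order
  below \<open>n\<close>.\<close>

lemma power_dvd_higher_pderiv:
  fixes q p :: "real poly"
  assumes "q ^ (k + j) dvd p"
  shows "q ^ k dvd (pderiv ^^ j) p"
  using assms
proof (induction j arbitrary: k)
  case (Suc j)
  then have "q ^ Suc k dvd (pderiv ^^ j) p" by (intro Suc.IH) simp
  then show ?case by (simp add: power_dvd_pderiv)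
qed simp

text \<open>Rolle's theorem gains one root in \<open>(-1, 1)\<close> with each of the first \<open>n\<close> derivatives, since
  \<open>\<plusminus>1\<close> are still roots before the step, and loses one with each later derivative.\<close>

lemma rodrigues_roots:
  fixes n j :: nat
  assumes "j \<le> 2 * n"
  shows "\<exists>T. finite T \<and> card T = (if j \<le> n then j else 2 * n - j) \<and> T \<subseteq> {-1<..<1::real}
      \<and> (\<forall>x\<in>T. poly ((pderiv ^^ j) ([:-1, 0, 1:] ^ n)) x = 0)"
  using assms
proof (induction j)
  case 0
  then show ?case by (intro exI[of _ "{}"]) auto
next
  case (Suc j)
  let ?P = "(pderiv ^^ j) ([:-1, 0, 1:] ^ n) :: real poly"
  obtain T where T: "finite T" "card T = (if j \<le> n then j else 2 * n - j)"
      "T \<subseteq> {-1<..<1::real}" "\<forall>x\<in>T. poly ?P x = 0"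
    using Suc by auto
  show ?case
  proof (cases "j < n")
    case True
    have "[:-1, 0, 1:] ^ Suc 0 dvd ?P"
      using True by (intro power_dvd_higher_pderiv le_imp_power_dvd) auto
    then have "[:-1, 0, 1:] dvd ?P" by (simp only: power_Suc power_0 mult_1_right)
    then obtain r where "?P = [:-1, 0, 1:] * r" by (rule dvdE)
    then have "poly ?P 1 = 0" "poly ?P (-1) = 0" by simp_all
    moreover have "finite (insert 1 (insert (-1) T))" using T by simp
    \<comment> \<open>The endpoints lie outside the open interval that contains \<open>T\<close>, so
      they are two new roots.\<close>
    moreover have "card (insert 1 (insert (-1) T)) = Suc (Suc j)"
      using T True by (subst card_insert_disjoint; force)+
    ultimately obtain U where U: "finite U" "card U = Suc j"
        "U \<subseteq> {Min (insert 1 (insert (-1) T))<..<Max (insert 1 (insert (-1) T))}"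
        "\<forall>x\<in>U. poly (pderiv ?P) x = 0"
      using rolle_finite_roots[of "insert 1 (insert (-1) T)" "Suc j" ?P] T by auto
    have "Min (insert 1 (insert (-1) T)) = -1"
      using T by (intro Min_eqI) (auto simp: less_imp_le)
    moreover have "Max (insert 1 (insert (-1) T)) = 1"
      using T by (intro Max_eqI) (auto simp: less_imp_le)
    ultimately have "U \<subseteq> {-1<..<1}" using U by simp
    then show ?thesis using U True by (intro exI[of _ U]) auto
  next
    case False
    define k where "k = 2 * n - Suc j"
    \<comment> \<open>At \<open>j = n\<close> the two expressions for the cardinality agree, so the
      descending count is available for every \<open>j \<ge> n\<close>.\<close>
    have cT: "card T = Suc k" using False T Suc.prems by (auto simp: k_def)
    then obtain U where U: "finite U" "card U = k" "U \<subseteq> {Min T<..<Max T}"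
        "\<forall>x\<in>U. poly (pderiv ?P) x = 0"
      using rolle_finite_roots[of T k ?P] T by auto
    have "T \<noteq> {}" using cT by auto
    then have "Min T \<in> T" "Max T \<in> T" using T by auto
    then have "U \<subseteq> {-1<..<1}" using U T by force
    then show ?thesis using U False by (intro exI[of _ U]) (auto simp: k_def)
  qed
qed

section \<open>Jacobi polynomials: normalisation and simple roots\<close>

lemma degree_legendre_kernel: "degree ([:-1, 0, 1::real:] ^ n) = 2 * n"
  by (simp add: degree_power_eq)

lemma degree_legendre_poly: "degree (legendre_poly n) = n"
  by (simp add: legendre_poly_def degree_higher_pderiv degree_legendre_kernel)

lemma degree_jacobi_neg_poly: "degree (jacobi_neg_poly n q) = q"
  by (simp add: jacobi_neg_poly_def jacobi_const_def degree_higher_pderiv degree_legendre_poly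
      del: funpow.simps)

text \<open>With \<open>N = q + n + 1\<close>, differentiating the leading term of degree
  \<open>2 * N\<close> in all \<open>N + n + 1\<close> times produces
  \<open>fact (2 * N) / fact q\<close>. The constant \<open>jacobi_const\<close> is what cancels
  this together with the factor \<open>1 / (2 ^ N * fact N)\<close> of Rodrigues' formula.\<close>

lemma lead_coeff_jacobi_neg_poly: "lead_coeff (jacobi_neg_poly n q) = 1"
proof -
  define N where "N = q + n + 1"
  have lc: "coeff ([:-1, 0, 1::real:] ^ N) (2 * N) = 1"
    using lead_coeff_power[of "[:-1, 0, 1::real:]" N] by (simp add: degree_legendre_kernel)
  have pf: "pochhammer (real (Suc a)) b = fact (a + b) / fact a" for a b
    using pochhammer_product[of a "a + b" "1::real"]
    by (simp add: pochhammer_fact[symmetric] add.commute)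
  have N: "q + (n + 1) = N" "N + N = 2 * N" by (simp_all add: N_def)
  have "coeff ((pderiv ^^ (n + 1)) ((pderiv ^^ N) ([:-1, 0, 1::real:] ^ N))) q
      = fact N / fact q * (fact (2 * N) / fact N)"
    unfolding coeff_higher_pderiv pf N lc by simp
  then have "coeff (jacobi_neg_poly n q) q = jacobi_const n (q + 2 * n + 2) *
      (fact N / fact q * (fact (2 * N) / fact N) / (2 ^ N * fact N))"
    unfolding jacobi_neg_poly_def legendre_poly_def higher_pderiv_smult N_def[symmetric] coeff_smult
    by simp
  also have "jacobi_const n (q + 2 * n + 2) = 2 ^ (q + n) * fact (q + n) * fact q / fact (2 * N - 1)"
    by (simp add: jacobi_const_def N_def algebra_simps numeral_3_eq_3)
  also have "fact (2 * N) = 2 * real N * fact (2 * N - 1)"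
    by (subst fact_reduce) (auto simp: N_def)
  also have "fact N = real N * fact (q + n)"
    by (simp add: N_def)
  also have "(2::real) ^ N = 2 * 2 ^ (q + n)" by (simp add: N_def)
  finally have "coeff (jacobi_neg_poly n q) q = 1" by (simp add: N_def)
  then show ?thesis by (simp add: degree_jacobi_neg_poly)
qed

text \<open>Up to a nonzero constant this is the derivative of order \<open>N + n + 1\<close> of
  \<open>[:-1, 0, 1:] ^ N\<close> with \<open>N = q + n + 1\<close>. The count for Rodrigues'
  formula gives \<open>2 * N - (N + n + 1) = q\<close> roots in the open interval, and the degree
  bound leaves no others.\<close>

lemma jacobi_neg_poly_roots:
  shows "card {x. poly (jacobi_neg_poly n q) x = 0} = q" (is "card ?R = q")
    and "{x. poly (jacobi_neg_poly n q) x = 0} \<subseteq> {-1<..<1}"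
    and "finite {x. poly (jacobi_neg_poly n q) x = 0}"
proof -
  have nz: "jacobi_neg_poly n q \<noteq> 0"
    using lead_coeff_jacobi_neg_poly[of n q] by auto
  show fin: "finite ?R" using poly_roots_finite[OF nz] .
  have le: "card ?R \<le> q" using card_poly_roots_bound[OF nz] by (simp add: degree_jacobi_neg_poly)
  define N where "N = q + n + 1"
  have Rdef: "?R = {x. poly ((pderiv ^^ (n + 1 + N)) ([:-1, 0, 1:] ^ N)) x = 0}"
    unfolding funpow_add o_apply jacobi_neg_poly_def legendre_poly_def higher_pderiv_smult
      N_def[symmetric] poly_smult by (simp add: jacobi_const_def del: funpow.simps)
  obtain T where T: "finite T" "card T = q" "T \<subseteq> {-1<..<1::real}" "T \<subseteq> ?R"
    using rodrigues_roots[of "n + 1 + N" N] unfolding Rdef by (auto simp: N_def)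
  have "T = ?R" using T le fin by (intro card_seteq) auto
  then show "card ?R = q" "?R \<subseteq> {-1<..<1}" using T by simp_all
qed

text \<open>Both sides are monic of degree \<open>q\<close> and agree at the \<open>q\<close>
  distinct roots, hence they are equal; in particular all roots are simple.\<close>

lemma jacobi_neg_poly_eq_prod:
  "jacobi_neg_poly n q = (\<Prod>x | poly (jacobi_neg_poly n q) x = 0. [:-x, 1:])" (is "_ = prod _ ?R")
proof (rule poly_eqI_degree_lead_coeff[where A = ?R and n = q])
  have "degree (prod (\<lambda>x. [:-x, 1:]) ?R) = q"
    by (subst degree_prod_sum_eq) (auto simp: jacobi_neg_poly_roots)
  moreover have "lead_coeff (prod (\<lambda>x. [:-x, 1:]) ?R) = 1"
    by (simp add: lead_coeff_prod)
  ultimately show "coeff (jacobi_neg_poly n q) q = coeff (prod (\<lambda>x. [:-x, 1:]) ?R) q"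
    and "degree (prod (\<lambda>x. [:-x, 1:]) ?R) \<le> q"
    using lead_coeff_jacobi_neg_poly[of n q] by (simp_all add: degree_jacobi_neg_poly)
qed (auto simp: jacobi_neg_poly_roots degree_jacobi_neg_poly poly_prod)

section \<open>The product form and the parity of \<open>\<Upsilon>\<close>\<close>

lemma node_1: "node m p M h 1 = M - h / 2"
  by (simp add: node_def)

lemma node_end:
  assumes "2 * m + 1 \<le> p"
  shows "node m p M h (p - 2 * m + 1) = M + h / 2"
  using assms by (simp add: node_def)

text \<open>Exchanges products over node indices for products over the root set, and makes the
  interior nodes distinct and interior.\<close>

lemma bij_betw_jacobi_root:
  "bij_betw (jacobi_root m p) {2..p - 2 * m} {x. poly (jacobi_neg_poly m (p - 2 * m - 1)) x = 0}"
    (is "bij_betw _ _ ?R")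
proof -
  let ?xs = "sorted_list_of_set ?R"
  have len: "length ?xs = p - 2 * m - 1"
    by (simp add: jacobi_neg_poly_roots)
  have "bij_betw ((!) ?xs) {..<p - 2 * m - 1} ?R"
    by (rule bij_betw_nth) (simp_all add: len jacobi_neg_poly_roots)
  moreover have "bij_betw (\<lambda>i. i - 2) {2..p - 2 * m} {..<p - 2 * m - 1}"
    by (rule bij_betwI[where g = "\<lambda>i. i + 2"]) auto
  ultimately have "bij_betw ((!) ?xs \<circ> (\<lambda>i. i - 2)) {2..p - 2 * m} ?R"
    by (rule bij_betw_trans[rotated])
  then show ?thesis by (simp add: jacobi_root_def[abs_def] o_def)
qed

lemma node_interior:
  assumes "i \<in> {2..p - 2 * m}"
  shows "node m p M h i = M + h * jacobi_root m p i / 2"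
  using assms by (auto simp: node_def)

lemma node_interior_mem:
  assumes "i \<in> {2..p - 2 * m}" "h > 0"
  shows "node m p M h i \<in> {M - h / 2<..<M + h / 2}"
proof -
  have "jacobi_root m p i \<in> {-1<..<1}"
    using bij_betw_apply[OF bij_betw_jacobi_root assms(1)] jacobi_neg_poly_roots(2) by blast
  then have "h * jacobi_root m p i < h * 1" "h * (-1) < h * jacobi_root m p i"
    using assms(2) by (intro mult_strict_left_mono; simp)+
  then show ?thesis using assms(1) by (simp add: node_interior)
qed

lemma inj_on_node_interior:
  assumes "h > 0"
  shows "inj_on (node m p M h) {2..p - 2 * m}"
  using assms bij_betw_imp_inj_on[OF bij_betw_jacobi_root[of m p]]
  by (auto simp: inj_on_def node_interior)

lemma jacobi_poly_eq_mult:
  assumes "2 * m + 1 \<le> p"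
  shows "jacobi_poly m (p + 1) = [:-1, 0, 1:] ^ (m + 1) * jacobi_neg_poly m (p - 2 * m - 1)"
proof -
  have "p - 2 * m - 1 + 2 * m + 2 = p + 1" "p - 2 * m - 1 + m + 1 = p + 1 - m - 1"
    using assms by simp_all
  then show ?thesis
    unfolding jacobi_poly_def jacobi_neg_poly_def by (simp only: mult_smult_right)
qed

lemma jacobi_poly_monic:
  assumes "2 * m + 1 \<le> p"
  shows "degree (jacobi_poly m (p + 1)) = p + 1" "lead_coeff (jacobi_poly m (p + 1)) = 1"
proof -
  have "jacobi_neg_poly m q \<noteq> 0" for q
    using lead_coeff_jacobi_neg_poly[of m q] by auto
  then show "degree (jacobi_poly m (p + 1)) = p + 1"
    unfolding jacobi_poly_eq_mult[OF assms] using assms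
    by (subst degree_mult_eq) (simp_all add: degree_legendre_kernel degree_jacobi_neg_poly
        del: power_Suc)
  show "lead_coeff (jacobi_poly m (p + 1)) = 1"
    unfolding jacobi_poly_eq_mult[OF assms] lead_coeff_mult lead_coeff_power
    by (simp add: lead_coeff_jacobi_neg_poly)
qed

lemma Upsilon_centred_monic:
  assumes "2 * m + 1 \<le> p" "h > 0"
  shows "degree (Upsilon_centred m p h) = p + 1" "coeff (Upsilon_centred m p h) (p + 1) = 1"
proof -
  show "degree (Upsilon_centred m p h) = p + 1"
    unfolding Upsilon_centred_def degree_smult_eq degree_pcompose jacobi_poly_monic(1)[OF assms(1)]
    using assms by simp
  have "coeff (jacobi_poly m (p + 1)) (p + 1) = 1"
    using jacobi_poly_monic[OF assms(1)] by simp
  then have "coeff (Upsilon_centred m p h) (p + 1) = (h / 2) ^ (p + 1) * (2 / h) ^ (p + 1)"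
    unfolding Upsilon_centred_def coeff_smult coeff_pcompose_linear by simp
  also have "\<dots> = 1" using assms by (simp flip: power_mult_distrib del: power_Suc)
  finally show "coeff (Upsilon_centred m p h) (p + 1) = 1" .
qed

text \<open>Under the substitution of \<open>2 * (x - M) / h\<close> each linear factor of
  \<open>jacobi_poly\<close> yields a node factor times \<open>2 / h\<close>. There are
  \<open>(2 * m + 2) + (p - 2 * m - 1) = p + 1\<close> such factors, which the scaling by
  \<open>(h / 2) ^ (p + 1)\<close> compensates.\<close>

lemma Upsilon_eq_prod:
  assumes "2 * m + 1 \<le> p" "h > 0"
  shows "Upsilon m p M h = [:-(M - h / 2), 1:] ^ (m + 1) * [:-(M + h / 2), 1:] ^ (m + 1)
      * (\<Prod>j\<in>{2..p - 2 * m}. [:- node m p M h j, 1:])"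
proof -
  let ?R = "{x. poly (jacobi_neg_poly m (p - 2 * m - 1)) x = 0}"
  define L where "L = [:-(2 * M / h), 2 / h:]"
  have lin: "pcompose [:- \<mu>, 1:] L = smult (2 / h) [:- (M + h * \<mu> / 2), 1:]" for \<mu>
    using assms by (simp add: L_def pcompose_pCons field_simps)
  have neg: "jacobi_neg_poly m (p - 2 * m - 1) = (\<Prod>j\<in>{2..p - 2 * m}. [:- jacobi_root m p j, 1:])"
    by (subst jacobi_neg_poly_eq_prod, subst prod.reindex_bij_betw[OF bij_betw_jacobi_root, symmetric])
      simp
  have "pcompose (jacobi_neg_poly m (p - 2 * m - 1)) L
      = (\<Prod>j\<in>{2..p - 2 * m}. smult (2 / h) [:- node m p M h j, 1:])"
    unfolding neg pcompose_prod by (intro prod.cong) (simp_all only: lin node_interior)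
  also have "\<dots> = smult ((2 / h) ^ (p - 2 * m - 1)) (\<Prod>j\<in>{2..p - 2 * m}. [:- node m p M h j, 1:])"
    by (simp only: prod_smult) simp
  finally have 1: "pcompose (jacobi_neg_poly m (p - 2 * m - 1)) L = \<dots>" .
  have kernel: "[:-1, 0, 1::real:] = [:-(-1), 1:] * [:-1, 1:]" by simp
  have 2: "pcompose ([:-1, 0, 1:] ^ (m + 1)) L = smult ((2 / h) ^ (2 * m + 2))
      ([:-(M - h / 2), 1:] ^ (m + 1) * [:-(M + h / 2), 1:] ^ (m + 1))"
    (is "_ = smult _ (?A ^ _ * ?B ^ _)")
  proof -
    have "pcompose [:-1, 0, 1:] L = smult (2 / h) ?A * smult (2 / h) ?B"
      unfolding kernel pcompose_mult lin by (simp add: field_simps)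
    also have "\<dots> = smult ((2 / h) ^ 2) (?A * ?B)"
      by (simp only: mult_smult_left mult_smult_right smult_smult power2_eq_square)
    finally have "pcompose ([:-1, 0, 1:] ^ (m + 1)) L = smult ((2 / h) ^ 2) (?A * ?B) ^ (m + 1)"
      by (simp only: pcompose_power)
    also have "\<dots> = smult (((2 / h) ^ 2) ^ (m + 1)) ((?A * ?B) ^ (m + 1))"
      by (rule smult_power)
    finally show ?thesis
      by (simp only: power_mult_distrib power_mult[symmetric]) (simp del: power_Suc)
  qed
  have "pcompose [:0, 2 / h:] [:-M, 1:] = L"
    by (simp add: L_def pcompose_pCons)
  then have "Upsilon m p M h = smult ((h / 2) ^ (p + 1)) (pcompose (jacobi_poly m (p + 1)) L)"
    by (simp only: Upsilon_def Upsilon_centred_def pcompose_smult flip: pcompose_assoc)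
  also have "\<dots> = smult ((h / 2) ^ (p + 1) * (2 / h) ^ (2 * m + 2) * (2 / h) ^ (p - 2 * m - 1))
      ([:-(M - h / 2), 1:] ^ (m + 1) * [:-(M + h / 2), 1:] ^ (m + 1)
      * (\<Prod>j\<in>{2..p - 2 * m}. [:- node m p M h j, 1:]))"
    unfolding jacobi_poly_eq_mult[OF assms(1)] pcompose_mult 1 2
    by (simp only: mult_smult_left mult_smult_right smult_smult ac_simps)
  also have "(h / 2) ^ (p + 1) * (2 / h) ^ (2 * m + 2) * (2 / h) ^ (p - 2 * m - 1)
      = (h / 2) ^ (p + 1) * (2 / h) ^ (p + 1)"
    using assms by (simp only: mult.assoc flip: power_add) simp
  also have "\<dots> = 1"
    using assms by (simp flip: power_mult_distrib del: power_Suc)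
  finally show ?thesis by simp
qed

section \<open>Parity of polynomials\<close>

text \<open>Only the parity of \<open>n\<close> matters, but a natural number in place of a flag
  lets parities add up under products and derivatives.\<close>

definition has_parity :: "nat \<Rightarrow> real poly \<Rightarrow> bool" where
  "has_parity n q \<longleftrightarrow> (\<forall>k. odd (k + n) \<longrightarrow> coeff q k = 0)"

lemma has_parity_mult:
  assumes "has_parity a q" "has_parity b r"
  shows "has_parity (a + b) (q * r)"
  unfolding has_parity_def coeff_mult
proof (intro allI impI sum.neutral ballI)
  fix k i :: nat
  assume "odd (k + (a + b))" "i \<in> {..k}"
  then have "odd (i + a) \<or> odd (k - i + b)" by auto
  then have "coeff q i = 0 \<or> coeff r (k - i) = 0"
    using assms unfolding has_parity_def by blast
  then show "coeff q i * coeff r (k - i) = 0" by simp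
qed

lemma has_parity_power:
  assumes "has_parity 0 q"
  shows "has_parity 0 (q ^ k)"
proof (induction k)
  case (Suc k)
  then show ?case using has_parity_mult[OF assms Suc] by simp
qed (auto simp: has_parity_def elim: oddE)

lemma has_parity_higher_pderiv:
  assumes "has_parity a q"
  shows "has_parity (a + k) ((pderiv ^^ k) q)"
  unfolding has_parity_def
proof (intro allI impI)
  fix n assume "odd (n + (a + k))"
  then have "odd ((n + k) + a)" by (simp add: ac_simps)
  then have "coeff q (n + k) = 0" using assms unfolding has_parity_def by blast
  then show "coeff ((pderiv ^^ k) q) n = 0" by (simp add: coeff_higher_pderiv)
qed

text \<open>Starting from an even polynomial, Rodrigues' formula takes \<open>p - m\<close>
  derivatives and the definition \<open>m + 1\<close> more, in total \<open>p + 1\<close>; the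
  remaining factor is even.\<close>

lemma has_parity_jacobi_poly:
  assumes "2 * m + 1 \<le> p"
  shows "has_parity (p + 1) (jacobi_poly m (p + 1))"
proof -
  have "has_parity 0 [:-1, 0, 1::real:]"
    by (auto simp: has_parity_def coeff_pCons split: nat.splits)
  then have ker: "has_parity 0 ([:-1, 0, 1::real:] ^ k)" for k
    by (rule has_parity_power)
  have "has_parity (0 + (p - m)) (legendre_poly (p - m))"
    using has_parity_higher_pderiv[OF ker] by (auto simp: legendre_poly_def has_parity_def)
  then have "has_parity (0 + (0 + (p - m) + (m + 1)))
      ([:-1, 0, 1:] ^ (m + 1) * (pderiv ^^ (m + 1)) (legendre_poly (p - m)))"
    by (intro has_parity_mult has_parity_higher_pderiv ker)
  then show ?thesis
    using assms by (auto simp: jacobi_poly_def has_parity_def simp del: funpow.simps power_Suc)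
qed

lemma has_parity_Upsilon_centred:
  assumes "2 * m + 1 \<le> p"
  shows "has_parity (p + 1) (Upsilon_centred m p h)"
  using has_parity_jacobi_poly[OF assms]
  by (auto simp: has_parity_def Upsilon_centred_def coeff_pcompose_linear)

section \<open>Long division by the centred \<open>Upsilon\<close>\<close>

definition Psi_centred :: "nat \<Rightarrow> nat \<Rightarrow> real \<Rightarrow> nat \<Rightarrow> real poly" where
  "Psi_centred m p h i = (\<Sum>l=0..i div 2. monom (psi_coeff m p h i l) (i - 2 * l))"

text \<open>The recursion for the coefficients of \<open>\<Psi>\<^sub>i\<close> is long division of \<open>y\<^bsup>p+i+1\<^esup>\<close> by the
  centred \<open>\<Upsilon>\<close>; parity makes the remaining coefficients of the quotient vanish.\<close>

lemma degree_monom_minus_Upsilon_mult_Psi: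
  assumes "2 * m + 1 \<le> p" "h > 0"
  shows "degree (monom 1 (p + i + 1) - Upsilon_centred m p h * Psi_centred m p h i) \<le> p"
proof (rule degree_le, intro allI impI)
  fix k assume k: "p < k"
  let ?U = "Upsilon_centred m p h" and ?a = "psi_coeff m p h i"
  have co: "coeff (?U * Psi_centred m p h i) k
      = (\<Sum>l=0..i div 2. if i - 2 * l \<le> k then ?a l * coeff ?U (k - (i - 2 * l)) else 0)"
    unfolding Psi_centred_def sum_distrib_left coeff_sum
    by (intro sum.cong refl) (simp add: mult.commute[of ?U] coeff_monom_mult)
  have big: "coeff ?U j = 0" if "j > p + 1" for j
    using that Upsilon_centred_monic(1)[OF assms] by (intro coeff_eq_0) simp
  have par: "coeff ?U j = 0" if "odd (j + (p + 1))" for j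
    using that has_parity_Upsilon_centred[OF assms(1)] by (auto simp: has_parity_def)
  have "coeff (?U * Psi_centred m p h i) k = (if k = p + i + 1 then 1 else 0)"
  proof (cases "k > p + i + 1")
    case True
    then show ?thesis unfolding co by (auto intro!: sum.neutral big)
  next
    case False
    \<comment> \<open>\<open>d\<close> measures the distance below the top exponent. Odd
      \<open>d\<close> is settled by parity, even \<open>d\<close> by the recursion for
      \<open>psi_coeff\<close>.\<close>
    define d where "d = p + i + 1 - k"
    have kd: "k = p + i + 1 - d" "d \<le> i" using False k by (auto simp: d_def)
    show ?thesis
    proof (cases "odd d")
      case True
      have "coeff ?U (k - (i - 2 * l)) = 0" if "l \<le> i div 2" "i - 2 * l \<le> k" for l
        using that True kd by (intro par) (auto simp: algebra_simps)
      moreover have "d \<noteq> 0" using True by (intro notI) simp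
      ultimately show ?thesis unfolding co using kd by (auto intro!: sum.neutral)
    next
      case False
      then obtain n where n: "d = 2 * n" by (auto elim: evenE)
      have n_le: "n \<le> i div 2" using kd n by simp
      \<comment> \<open>The guard sets the term to 0 where the true index would be negative;
        truncated subtraction alone would read the constant coefficient there.\<close>
      define t where "t l = ?a l
        * (if 2 * n \<le> p + 1 + 2 * l then coeff ?U (p + 1 + 2 * l - 2 * n) else 0)" for l
      have "coeff (?U * Psi_centred m p h i) k = (\<Sum>l=0..i div 2. t l)"
        unfolding co t_def
      proof (intro sum.cong refl)
        fix l assume "l \<in> {0..i div 2}"
        then have "2 * l \<le> i" by simp
        then have "(i - 2 * l \<le> k) = (2 * n \<le> p + 1 + 2 * l)"
            "k - (i - 2 * l) = p + 1 + 2 * l - 2 * n"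
          using kd n by auto
        then show "(if i - 2 * l \<le> k then ?a l * coeff ?U (k - (i - 2 * l)) else 0) =
          ?a l * (if 2 * n \<le> p + 1 + 2 * l then coeff ?U (p + 1 + 2 * l - 2 * n) else 0)" by simp
      qed
      \<comment> \<open>Terms with \<open>l > n\<close> refer to coefficients of \<open>?U\<close>
        above its degree.\<close>
      also have "\<dots> = (\<Sum>l\<in>{0..n}. t l)"
        using n_le by (intro sum.mono_neutral_right) (auto simp: t_def intro!: big)
      also have "\<dots> = (\<Sum>j\<in>{0..n}. t (n - j))"
        by (rule sum.reindex_bij_witness[of _ "\<lambda>j. n - j" "\<lambda>j. n - j"]) auto
      \<comment> \<open>For larger \<open>j\<close> the guard in \<open>t\<close> fails, which
        explains the upper bound in the recursion.\<close>
      also have "\<dots> = (\<Sum>j\<in>{0..min n ((p + 1) div 2)}. t (n - j))"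
        by (intro sum.mono_neutral_right) (auto simp: t_def)
      also have "\<dots> = (\<Sum>j\<in>{0..min n ((p + 1) div 2)}. ?a (n - j) * a_hat m p h (p + 1 - 2 * j))"
      proof (intro sum.cong refl)
        fix j assume "j \<in> {0..min n ((p + 1) div 2)}"
        then have "2 * n \<le> p + 1 + 2 * (n - j)" "p + 1 + 2 * (n - j) - 2 * n = p + 1 - 2 * j"
          by auto
        then show "t (n - j) = ?a (n - j) * a_hat m p h (p + 1 - 2 * j)"
          by (simp add: t_def a_hat_def)
      qed
      \<comment> \<open>The term \<open>j = 0\<close> carries the leading coefficient 1, so for
        \<open>n > 0\<close> the recursion says precisely that the whole sum vanishes.\<close>
      also have "\<dots> = ?a n + (\<Sum>j\<in>{1..min n ((p + 1) div 2)}. ?a (n - j) * a_hat m p h (p + 1 - 2 * j))"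
        using Upsilon_centred_monic(2)[OF assms] by (simp add: sum.atLeast_Suc_atMost a_hat_def)
      also have "\<dots> = (if n = 0 then 1 else 0)"
        by (subst psi_coeff.simps) simp
      finally show ?thesis using kd n by auto
    qed
  qed
  then show "coeff (monom 1 (p + i + 1) - ?U * Psi_centred m p h i) k = 0" by simp
qed

section \<open>Hermite interpolation at the nodes\<close>

text \<open>Linear factors at distinct points are coprime: splitting off the power at
  \<open>a\<close> leaves the order at every other point unchanged.\<close>

lemma prod_linear_power_dvd:
  fixes p :: "real poly"
  assumes "finite A" "\<And>a. a \<in> A \<Longrightarrow> [:-a, 1:] ^ k a dvd p"
  shows "(\<Prod>a\<in>A. [:-a, 1:] ^ k a) dvd p"
  using assms
proof (induction A arbitrary: p rule: finite_induct)
  case (insert a A)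
  obtain r where r: "p = [:-a, 1:] ^ k a * r" using insert.prems by (meson dvdE insertI1)
  have "[:-b, 1:] ^ k b dvd r" if "b \<in> A" for b
  proof (cases "r = 0")
    case False
    have "b \<noteq> a" using that insert.hyps by auto
    then have "order b ([:-a, 1:] ^ k a) = 0" by (intro order_0I) simp
    moreover have "p \<noteq> 0" using False by (simp add: r)
    ultimately have "order b p = order b r" unfolding r by (subst order_mult) simp_all
    moreover have "k b \<le> order b p"
      using insert.prems[of b] that \<open>p \<noteq> 0\<close> by (simp add: order_divides)
    ultimately show ?thesis by (simp add: order_divides)
  qed simp
  then have "(\<Prod>b\<in>A. [:-b, 1:] ^ k b) dvd r" by (rule insert.IH)
  then show ?case using insert.hyps by (simp add: r mult_dvd_mono)
qed simp

text \<open>The data form an arbitrary family \<open>f\<close>, so that one predicate serves both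
  the derivatives of \<open>u\<close> within the interval and the formal derivatives of
  polynomials.\<close>

definition interpolates ::
  "nat \<Rightarrow> nat \<Rightarrow> real \<Rightarrow> real \<Rightarrow> (nat \<Rightarrow> real \<Rightarrow> real) \<Rightarrow> real poly \<Rightarrow> bool" where
  "interpolates m p M h f W \<longleftrightarrow> degree W \<le> p
     \<and> (\<forall>i\<le>m. poly ((pderiv ^^ i) W) (M - h / 2) = f i (M - h / 2)
            \<and> poly ((pderiv ^^ i) W) (M + h / 2) = f i (M + h / 2))
     \<and> (\<forall>i\<in>{2..p - 2 * m}. poly W (node m p M h i) = f 0 (node m p M h i))"

lemma higher_pderiv_diff:
  fixes P Q :: "real poly"
  shows "(pderiv ^^ n) (P - Q) = (pderiv ^^ n) P - (pderiv ^^ n) Q"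
  by (induction n) (simp_all add: pderiv_diff)

text \<open>The difference of two interpolants has zero data, hence is a multiple of
  \<open>Upsilon\<close>, whose degree \<open>p + 1\<close> exceeds that of the difference.\<close>

lemma interpolates_unique:
  assumes "2 * m + 1 \<le> p" "h > 0"
    and "interpolates m p M h f V" "interpolates m p M h f W"
  shows "V = W"
proof -
  let ?D = "V - W"
  have ends: "[:-(M - h / 2), 1:] ^ (m + 1) dvd ?D" "[:-(M + h / 2), 1:] ^ (m + 1) dvd ?D"
    unfolding linear_power_dvd_iff_higher_pderiv
    using assms(3,4) by (auto simp: interpolates_def higher_pderiv_diff)
  have nodes: "[:- node m p M h i, 1:] dvd ?D" if "i \<in> {2..p - 2 * m}" for i
  proof -
    have "poly ?D (node m p M h i) = 0"
      using assms(3,4) that by (auto simp: interpolates_def)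
    then show ?thesis by (simp only: poly_eq_0_iff_dvd)
  qed
  define N where "N = node m p M h ` {2..p - 2 * m}"
  \<comment> \<open>The required multiplicity at each point; the endpoints get \<open>m + 1\<close>
    because the interior nodes lie strictly between them.\<close>
  define k where "k c = (if c \<in> N then 1 else m + 1)" for c
  have "N \<subseteq> {M - h / 2<..<M + h / 2}"
    using node_interior_mem[OF _ assms(2)] unfolding N_def by blast
  then have notin: "M - h / 2 \<notin> insert (M + h / 2) N" "M + h / 2 \<notin> N"
    using assms(2) by auto
  have k: "k (M - h / 2) = m + 1" "k (M + h / 2) = m + 1" "\<And>c. c \<in> N \<Longrightarrow> k c = 1"
    using notin by (simp_all add: k_def)
  have "finite N" by (simp add: N_def)
  have "(\<Prod>c\<in>insert (M - h / 2) (insert (M + h / 2) N). [:-c, 1:] ^ k c) dvd ?D"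
  proof (rule prod_linear_power_dvd)
    fix c assume "c \<in> insert (M - h / 2) (insert (M + h / 2) N)"
    then consider "c = M - h / 2" | "c = M + h / 2" | "c \<in> N" by auto
    then show "[:-c, 1:] ^ k c dvd ?D"
    proof cases
      case 3
      then show ?thesis using nodes unfolding k(3)[OF 3] power_one_right by (auto simp: N_def)
    qed (use ends k in simp_all)
  qed (simp add: N_def)
  also have "(\<Prod>c\<in>insert (M - h / 2) (insert (M + h / 2) N). [:-c, 1:] ^ k c)
      = [:-(M - h / 2), 1:] ^ (m + 1) * ([:-(M + h / 2), 1:] ^ (m + 1) * (\<Prod>c\<in>N. [:-c, 1:]))"
    using notin \<open>finite N\<close> by (simp only: prod.insert finite_insert k(1,2) simp_thms)
      (simp add: k(3) del: power_Suc)
  also have "(\<Prod>c\<in>N. [:-c, 1:]) = (\<Prod>j\<in>{2..p - 2 * m}. [:- node m p M h j, 1:])"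
    unfolding N_def by (subst prod.reindex[OF inj_on_node_interior[OF assms(2)]]) simp
  finally have "Upsilon m p M h dvd ?D"
    unfolding Upsilon_eq_prod[OF assms(1,2)] by (simp only: mult.assoc)
  moreover have "degree (Upsilon m p M h) = p + 1"
    using Upsilon_centred_monic(1)[OF assms(1,2)] by (simp add: Upsilon_def degree_pcompose)
  moreover have "degree ?D \<le> p"
    using assms(3,4) by (auto simp: interpolates_def intro: degree_diff_le)
  ultimately have "?D = 0"
    by (metis Suc_eq_plus1 dvd_imp_degree_le not_less_eq_eq)
  then show ?thesis by simp
qed

text \<open>A multiple of \<open>Upsilon\<close> has zero data, so subtracting it preserves the data
  of \<open>P\<close>.\<close>

lemma interpolates_minus_Upsilon_mult:
  assumes "2 * m + 1 \<le> p" "h > 0" "degree (P - Upsilon m p M h * Q) \<le> p"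
  shows "interpolates m p M h (\<lambda>i. poly ((pderiv ^^ i) P)) (P - Upsilon m p M h * Q)"
proof -
  let ?U = "Upsilon m p M h"
  have "[:-(M - h / 2), 1:] ^ (m + 1) dvd ?U * Q" "[:-(M + h / 2), 1:] ^ (m + 1) dvd ?U * Q"
    unfolding Upsilon_eq_prod[OF assms(1,2)] by (simp_all add: dvd_mult2 del: power_Suc)
  then have "poly ((pderiv ^^ i) (?U * Q)) b = 0"
    if "i \<le> m" "b = M - h / 2 \<or> b = M + h / 2" for i b
    using that unfolding linear_power_dvd_iff_higher_pderiv by auto
  moreover have "poly ?U (node m p M h i) = 0" if "i \<in> {2..p - 2 * m}" for i
    unfolding Upsilon_eq_prod[OF assms(1,2)] using that by (auto simp: poly_prod)
  ultimately show ?thesis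
    using assms(3) by (simp add: interpolates_def higher_pderiv_diff)
qed

text \<open>The hypothesis \<open>a < b\<close> makes the derivative within the interval unique,
  also at the endpoints. The induction runs over all \<open>x\<close> because the next derivative
  depends on the previous one at neighbouring points.\<close>

lemma nderiv_within_poly:
  assumes "a < b" "x \<in> {a..b}"
  shows "nderiv_within {a..b} (poly q) i x = poly ((pderiv ^^ i) q) x"
  using assms(2)
proof (induction i arbitrary: x)
  case (Suc i)
  let ?q = "(pderiv ^^ i) q"
  have "(poly ?q has_vector_derivative poly (pderiv ?q) x) (at x within {a..b})"
    using poly_DERIV[of ?q x] unfolding has_real_derivative_iff_has_vector_derivative
    by (rule has_vector_derivative_at_within)
  then have "(nderiv_within {a..b} (poly q) i has_vector_derivative poly (pderiv ?q) x)
      (at x within {a..b})"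
    using Suc.prems Suc.IH by (rule has_vector_derivative_transform[rotated 2])
  then show ?case
    using Suc.prems assms(1) by (simp add: vector_derivative_within_closed_interval)
qed simp

text \<open>By uniqueness, exhibiting one interpolant resolves the definite description.\<close>

lemma hermite_jacobi_eqI:
  assumes "2 * m + 1 \<le> p" "h > 0"
    and "interpolates m p M h (nderiv_within {M - h / 2..M + h / 2} u) W"
  shows "hermite_jacobi m p M h u = W"
proof -
  have "hermite_jacobi m p M h u
      = (THE W. interpolates m p M h (nderiv_within {M - h / 2..M + h / 2} u) W)"
    by (simp add: hermite_jacobi_def interpolates_def)
  also have "\<dots> = W"
    using assms by (blast intro: interpolates_unique)
  finally show ?thesis .
qed

lemma interpolates_poly_iff:
  assumes "h > 0"
  shows "interpolates m p M h (nderiv_within {M - h / 2..M + h / 2} (poly P)) W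
    \<longleftrightarrow> interpolates m p M h (\<lambda>i. poly ((pderiv ^^ i) P)) W"
proof -
  have "nderiv_within {M - h / 2..M + h / 2} (poly P) i b = poly ((pderiv ^^ i) P) b"
    if "b = M - h / 2 \<or> b = M + h / 2" for b i
    using assms that by (intro nderiv_within_poly) auto
  then show ?thesis by (simp add: interpolates_def)
qed

section \<open>The quotients \<open>Psi\<close> in powers of \<open>x - M\<close>\<close>

definition Psi_poly :: "nat \<Rightarrow> nat \<Rightarrow> real \<Rightarrow> real \<Rightarrow> nat \<Rightarrow> real poly" where
  "Psi_poly m p M h i =
     (\<Sum>l=0..i div 2. smult (psi_coeff m p h i l) ([:-M, 1:] ^ (i - 2 * l)))"

lemma degree_power_minus_Upsilon_mult_Psi_poly:
  assumes "2 * m + 1 \<le> p" "h > 0"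
  shows "degree ([:-M, 1:] ^ (p + i + 1) - Upsilon m p M h * Psi_poly m p M h i) \<le> p"
proof -
  have mon: "pcompose (monom c n) [:-M, 1:] = smult c ([:-M, 1:] ^ n)" for c n
    by (simp add: monom_altdef pcompose_smult pcompose_power pcompose_pCons)
  have "[:-M, 1:] ^ (p + i + 1) - Upsilon m p M h * Psi_poly m p M h i
    = pcompose (monom 1 (p + i + 1) - Upsilon_centred m p h * Psi_centred m p h i) [:-M, 1:]"
    by (simp only: Upsilon_def Psi_poly_def Psi_centred_def pcompose_diff pcompose_mult pcompose_sum
        mon smult_1_left)
  then show ?thesis
    using degree_monom_minus_Upsilon_mult_Psi[OF assms, of i] by (simp add: degree_pcompose)
qed

text \<open>The long division leaves a remainder of degree at most \<open>p\<close> with the same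
  data as the power, which is therefore its interpolant; the numerator is what was
  subtracted.\<close>

lemma Psi_numerator_eq:
  assumes "2 * m + 1 \<le> p" "h > 0"
  shows "Psi_numerator m p M h i = Upsilon m p M h * Psi_poly m p M h i"
proof -
  have "(\<lambda>x. (x - M) ^ (p + i + 1)) = poly ([:-M, 1:] ^ (p + i + 1))"
    unfolding poly_power by (simp add: fun_eq_iff)
  then have "hermite_jacobi m p M h (\<lambda>x. (x - M) ^ (p + i + 1))
      = [:-M, 1:] ^ (p + i + 1) - Upsilon m p M h * Psi_poly m p M h i"
    using assms
    by (intro hermite_jacobi_eqI)
      (simp_all only: interpolates_poly_iff interpolates_minus_Upsilon_mult
        degree_power_minus_Upsilon_mult_Psi_poly)
  then show ?thesis by (simp only: Psi_numerator_def diff_diff_eq2 add_diff_cancel_left')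
qed

lemma Psi_eq:
  assumes "2 * m + 1 \<le> p" "h > 0"
  shows "Psi m p M h i = Psi_poly m p M h i"
proof -
  have "Upsilon m p M h \<noteq> 0"
    using Upsilon_centred_monic(1)[OF assms] by (auto simp: Upsilon_def pcompose_eq_0_iff)
  then show ?thesis by (simp add: Psi_def Psi_numerator_eq[OF assms])
qed

section \<open>Basis polynomials of the interpolation problem\<close>

text \<open>The solution is the truncated reciprocal of the power series with coefficients
  \<open>g\<close>, which is invertible as its constant term is 1. The system is triangular with
  unit diagonal, whence uniqueness, as the definite description in \<open>end_coeffs\<close>
  requires.\<close>

lemma truncated_inverse_unique:
  fixes g :: "nat \<Rightarrow> real"
  assumes "g 0 = 1"
  shows "\<exists>!c. (\<forall>j>N. c j = 0) \<and> (\<forall>n\<le>N. (\<Sum>j\<le>n. c j * g (n - j)) = (if n = 0 then 1 else 0))"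
proof (rule ex_ex1I)
  define c where "c j = (if j \<le> N then fps_nth (inverse (Abs_fps g)) j else 0)" for j
  have inv: "inverse (Abs_fps g) * Abs_fps g = 1"
    using assms by (intro inverse_mult_eq_1) simp
  have "(\<Sum>j\<le>n. c j * g (n - j)) = (if n = 0 then 1 else 0)" if "n \<le> N" for n
  proof -
    have "(\<Sum>j\<le>n. c j * g (n - j)) = fps_nth (inverse (Abs_fps g) * Abs_fps g) n"
      using that unfolding fps_mult_nth atLeast0AtMost by (intro sum.cong) (auto simp: c_def)
    then show ?thesis unfolding inv by simp
  qed
  then show "\<exists>c. (\<forall>j>N. c j = 0) \<and> (\<forall>n\<le>N. (\<Sum>j\<le>n. c j * g (n - j)) = (if n = 0 then 1 else 0))"
    by (intro exI[of _ c]) (simp add: c_def)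
next
  fix c d :: "nat \<Rightarrow> real"
  assume c: "(\<forall>j>N. c j = 0) \<and> (\<forall>n\<le>N. (\<Sum>j\<le>n. c j * g (n - j)) = (if n = 0 then 1 else 0))"
    and d: "(\<forall>j>N. d j = 0) \<and> (\<forall>n\<le>N. (\<Sum>j\<le>n. d j * g (n - j)) = (if n = 0 then 1 else 0))"
  have "c n = d n" for n
  proof (induction n rule: less_induct)
    case (less n)
    show ?case
    proof (cases "n \<le> N")
      case True
      have split: "(\<Sum>j\<le>n. e j * g (n - j)) = (\<Sum>j<n. e j * g (n - j)) + e n" for e :: "nat \<Rightarrow> real"
        using assms by (simp flip: lessThan_Suc_atMost)
      have "(\<Sum>j\<le>n. c j * g (n - j)) = (\<Sum>j\<le>n. d j * g (n - j))"
        using c d True by simp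
      then show ?thesis unfolding split using less by simp
    next
      case False
      then show ?thesis using c d by simp
    qed
  qed
  then show "c = d" by auto
qed

text \<open>In the expansion at \<open>b\<close> the factor of order \<open>l\<close> kills all
  derivatives below \<open>l\<close>, while the derivative of order \<open>n + l\<close> is a
  multiple of the convolution of \<open>c\<close> with the Taylor coefficients of \<open>G\<close>.
  The endpoint conditions thus make \<open>c\<close> a truncated reciprocal of
  \<open>G\<close>.\<close>

lemma higher_pderiv_end_basis:
  fixes G :: "real poly" and c :: "nat \<Rightarrow> real"
  assumes "l \<le> m"
  shows "(\<forall>k\<le>m. poly ((pderiv ^^ k)
          (smult (1 / fact l) (\<Sum>j\<le>m - l. smult (c j) ([:- b, 1:] ^ (j + l))) * G)) b
        = (if k = l then 1 else 0))
    \<longleftrightarrow> (\<forall>n\<le>m - l. (\<Sum>j\<le>n. c j * coeff (pcompose G [:b, 1:]) (n - j)) = (if n = 0 then 1 else 0))"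
    (is "?lhs \<longleftrightarrow> ?rhs")
proof -
  let ?E = "smult (1 / fact l) (\<Sum>j\<le>m - l. smult (c j) ([:- b, 1:] ^ (j + l))) * G"
  define g where "g = pcompose G [:b, 1:]"
  have E: "pcompose ?E [:b, 1:] = smult (1 / fact l) (\<Sum>j\<le>m - l. monom (c j) (j + l) * g)"
    unfolding pcompose_mult pcompose_smult pcompose_sum pcompose_power g_def
    by (simp add: pcompose_pCons monom_altdef sum_distrib_right)
  have low: "poly ((pderiv ^^ k) ?E) b = 0" if "k < l" for k
    using that unfolding poly_higher_pderiv_eq_coeff_shift E
    by (simp add: coeff_sum coeff_monom_mult)
  have high: "poly ((pderiv ^^ (n + l)) ?E) b = fact (n + l) / fact l * (\<Sum>j\<le>n. c j * coeff g (n - j))"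
    if "n \<le> m - l" for n
  proof -
    have "(\<Sum>j\<le>m - l. coeff (monom (c j) (j + l) * g) (n + l))
        = (\<Sum>j\<le>n. coeff (monom (c j) (j + l) * g) (n + l))"
      using that by (intro sum.mono_neutral_right) (auto simp: coeff_monom_mult)
    also have "\<dots> = (\<Sum>j\<le>n. c j * coeff g (n - j))"
      by (intro sum.cong) (auto simp: coeff_monom_mult)
    finally show ?thesis
      unfolding poly_higher_pderiv_eq_coeff_shift E by (simp add: coeff_sum)
  qed
  have "?lhs \<longleftrightarrow> (\<forall>n\<le>m - l. poly ((pderiv ^^ (n + l)) ?E) b = (if n = 0 then 1 else 0))"
  proof safe
    fix n assume lhs: ?lhs and "n \<le> m - l"
    then have "n + l \<le> m" using assms by simp
    then have "poly ((pderiv ^^ (n + l)) ?E) b = (if n + l = l then 1 else 0)"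
      using lhs by blast
    then show "poly ((pderiv ^^ (n + l)) ?E) b = (if n = 0 then 1 else 0)" by simp
  next
    fix k assume r: "\<forall>n\<le>m - l. poly ((pderiv ^^ (n + l)) ?E) b = (if n = 0 then 1 else 0)"
      and "k \<le> m"
    show "poly ((pderiv ^^ k) ?E) b = (if k = l then 1 else 0)"
    proof (cases "k < l")
      case True
      then have "k \<noteq> l" by simp
      then show ?thesis using low[OF True] by (simp only: if_False)
    next
      case False
      then have k: "k - l + l = k" "k - l \<le> m - l" "k - l = 0 \<longleftrightarrow> k = l"
        using \<open>k \<le> m\<close> by auto
      show ?thesis using r[rule_format, OF k(2)] by (simp only: k)
    qed
  qed
  also have "\<dots> \<longleftrightarrow> ?rhs"
  proof -
    \<comment> \<open>The factor \<open>fact (n + l) / fact l\<close> is 1 for \<open>n = 0\<close>;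
      for \<open>n > 0\<close> it is nonzero and the right side is 0.\<close>
    have "poly ((pderiv ^^ (n + l)) ?E) b = (if n = 0 then 1 else 0)
      \<longleftrightarrow> (\<Sum>j\<le>n. c j * coeff g (n - j)) = (if n = 0 then 1 else 0)" if "n \<le> m - l" for n
      unfolding high[OF that] by simp
    then show ?thesis unfolding g_def[symmetric] by blast
  qed
  finally show ?thesis .
qed

lemma end_basis_end_coeffs:
  assumes "l \<le> m" "k \<le> m" "b \<noteq> b'" "\<And>j. j \<in> {2..p - 2 * m} \<Longrightarrow> b \<noteq> node m p M h j"
  shows "poly ((pderiv ^^ k) (end_basis m p M h b b' (end_coeffs m p M h b b' l) l)) b
    = (if k = l then 1 else 0)"
proof -
  \<comment> \<open>The part of the basis polynomial free of \<open>c\<close>, normalised to take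
    the value 1 at \<open>b\<close>; this supplies the unit constant term.\<close>
  define G where "G = smult (1 / ((b - b') ^ (m + 1) * (\<Prod>j\<in>{2..p - 2 * m}. b - node m p M h j)))
       ([:- b', 1:] ^ (m + 1) * (\<Prod>j\<in>{2..p - 2 * m}. [:- node m p M h j, 1:]))"
  have "poly G b = 1"
    unfolding G_def poly_smult poly_mult poly_power poly_prod using assms(3,4) by simp
  then have "coeff (pcompose G [:b, 1:]) 0 = 1"
    by (simp add: poly_pcompose flip: poly_0_coeff_0)
  from truncated_inverse_unique[of "coeff (pcompose G [:b, 1:])" "m - l", OF this]
  have "\<exists>!c. (\<forall>j>m - l. c j = 0)
     \<and> (\<forall>k\<le>m. poly ((pderiv ^^ k) (end_basis m p M h b b' c l)) b = (if k = l then 1 else 0))"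
    unfolding end_basis_def G_def[symmetric] higher_pderiv_end_basis[OF assms(1)] .
  from theI'[OF this] show ?thesis
    using assms(2) unfolding end_coeffs_def by blast
qed

lemma end_basis_opposite:
  assumes "k \<le> m"
  shows "poly ((pderiv ^^ k) (end_basis m p M h b b' c l)) b' = 0"
proof -
  have "[:-b', 1:] ^ (m + 1) dvd end_basis m p M h b b' c l"
    unfolding end_basis_def by (intro dvd_mult dvd_smult dvd_mult2 dvd_refl)
  then show ?thesis
    using assms unfolding linear_power_dvd_iff_higher_pderiv by simp
qed

lemma end_basis_node:
  assumes "j \<in> {2..p - 2 * m}"
  shows "poly (end_basis m p M h b b' c l) (node m p M h j) = 0"
  using assms unfolding end_basis_def poly_mult poly_smult poly_prod by auto

lemma degree_end_basis:
  assumes "2 * m + 1 \<le> p" "l \<le> m"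
  shows "degree (end_basis m p M h b b' c l) \<le> p"
proof -
  have "degree (\<Sum>j\<le>m - l. smult (c j) ([:- b, 1:] ^ (j + l))) \<le> m"
    using assms(2) by (intro degree_sum_le) (auto simp: degree_linear_power intro!: order.trans[OF degree_smult_le])
  then have "degree (smult (1 / fact l) (\<Sum>j\<le>m - l. smult (c j) ([:- b, 1:] ^ (j + l)))) \<le> m"
    by (rule order.trans[OF degree_smult_le])
  moreover have "degree (\<Prod>j\<in>{2..p - 2 * m}. [:- node m p M h j, 1:]) \<le> p - 2 * m - 1"
    by (rule order.trans[OF degree_prod_sum_le]) auto
  then have "degree ([:- b', 1:] ^ (m + 1) * (\<Prod>j\<in>{2..p - 2 * m}. [:- node m p M h j, 1:]))
      \<le> m + 1 + (p - 2 * m - 1)"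
    by (intro order.trans[OF degree_mult_le] add_mono) (simp_all only: degree_linear_power)
  ultimately have "degree (end_basis m p M h b b' c l) \<le> m + (m + 1 + (p - 2 * m - 1))"
    unfolding end_basis_def
    by (rule order.trans[OF degree_mult_le add_mono[OF _ order.trans[OF degree_smult_le]]])
  then show ?thesis using assms by simp
qed

lemma degree_L_hat:
  assumes "2 * m + 1 \<le> p" "i \<in> {2..p - 2 * m}"
  shows "degree (L_hat m p M h i) \<le> p"
proof -
  have "degree (\<Prod>j\<in>{2..p - 2 * m} - {i}. smult (a j) [:- b j, 1:]) \<le> p - 2 * m - 2" for a b :: "nat \<Rightarrow> real"
  proof -
    have "degree (\<Prod>j\<in>{2..p - 2 * m} - {i}. smult (a j) [:- b j, 1:])
        \<le> sum (degree \<circ> (\<lambda>j. smult (a j) [:- b j, 1:])) ({2..p - 2 * m} - {i})"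
      by (rule degree_prod_sum_le) simp
    also have "\<dots> \<le> (\<Sum>j\<in>{2..p - 2 * m} - {i}. 1)"
      by (intro sum_mono) simp
    finally have "degree (\<Prod>j\<in>{2..p - 2 * m} - {i}. smult (a j) [:- b j, 1:])
        \<le> card ({2..p - 2 * m} - {i})" by (simp only: card_eq_sum)
    then show ?thesis using assms by simp
  qed
  then have "degree (L_hat m p M h i) \<le> (m + 1) + (m + 1) + (p - 2 * m - 2)"
    unfolding L_hat_def Let_def
    by (intro order.trans[OF degree_mult_le] add_mono order.trans[OF degree_smult_le])
      (simp_all only: degree_linear_power)
  \<comment> \<open>The existence of an interior index \<open>i\<close> forces
    \<open>p - 2 * m \<ge> 2\<close>, so the truncated subtraction is exact.\<close>
  moreover have "(m + 1) + (m + 1) + (p - 2 * m - 2) = p"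
    using assms(2) unfolding atLeastAtMost_iff by linarith
  ultimately show ?thesis by simp
qed

lemma L_hat_node:
  assumes "h > 0" "2 * m + 1 \<le> p" "i \<in> {2..p - 2 * m}" "j \<in> {2..p - 2 * m}"
  shows "poly (L_hat m p M h i) (node m p M h j) = (if i = j then 1 else 0)"
proof (cases "i = j")
  case True
  have "node m p M h i \<noteq> node m p M h k" if "k \<in> {2..p - 2 * m} - {i}" for k
    using that assms(3) inj_on_node_interior[OF assms(1), of m p M] by (auto simp: inj_on_def)
  moreover have "node m p M h i \<noteq> node m p M h 1" "node m p M h i \<noteq> node m p M h (p - 2 * m + 1)"
    using node_interior_mem[OF assms(3,1), of M] unfolding node_1 node_end[OF assms(2)] by auto
  ultimately show ?thesis
    using True unfolding L_hat_def Let_def poly_mult poly_smult poly_power poly_prod by simp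
next
  case False
  then have "\<exists>k\<in>{2..p - 2 * m} - {i}. poly
      (smult (1 / (node m p M h i - node m p M h k)) [:- node m p M h k, 1:]) (node m p M h j) = 0"
    using assms(4) by (intro bexI[of _ j]) auto
  then show ?thesis
    using False unfolding L_hat_def Let_def poly_mult poly_prod by (simp add: prod_zero)
qed

lemma L_hat_ends:
  assumes "2 * m + 1 \<le> p" "k \<le> m" "b = M - h / 2 \<or> b = M + h / 2"
  shows "poly ((pderiv ^^ k) (L_hat m p M h i)) b = 0"
proof -
  have "[:-(M - h / 2), 1:] ^ (m + 1) dvd L_hat m p M h i" "[:-(M + h / 2), 1:] ^ (m + 1) dvd L_hat m p M h i"
    unfolding L_hat_def Let_def node_1 node_end[OF assms(1)]
    by (intro dvd_mult dvd_smult dvd_mult2 dvd_refl)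
      (intro dvd_mult2 dvd_mult dvd_smult dvd_refl)
  then show ?thesis
    using assms unfolding linear_power_dvd_iff_higher_pderiv by auto
qed

text \<open>Each basis polynomial is dual to one datum and has all other data zero. This proves
  existence for arbitrary data and is applied below to both \<open>u\<close> and
  \<open>v\<close>.\<close>

lemma interpolates_basis_sum:
  assumes "2 * m + 1 \<le> p" "h > 0"
  shows "interpolates m p M h f
    ((\<Sum>i=2..p - 2 * m. smult (f 0 (node m p M h i)) (L_hat m p M h i))
      + (\<Sum>l=0..m. smult (f l (M - h / 2)) (A_hat m p M h l))
      + (\<Sum>l=0..m. smult (f l (M + h / 2)) (B_hat m p M h l)))"
proof -
  let ?a = "M - h / 2" and ?b = "M + h / 2"
  have ne: "?a \<noteq> ?b" "?b \<noteq> ?a" using assms(2) by auto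
  have nodes: "?a \<noteq> node m p M h j" "?b \<noteq> node m p M h j" if "j \<in> {2..p - 2 * m}" for j
    using node_interior_mem[OF that assms(2), of M] by auto
  have A: "A_hat m p M h l = end_basis m p M h ?a ?b (end_coeffs m p M h ?a ?b l) l"
    and B: "B_hat m p M h l = end_basis m p M h ?b ?a (end_coeffs m p M h ?b ?a l) l" for l
    by (simp_all only: A_hat_def B_hat_def Let_def node_1 node_end[OF assms(1)])
  have L_ends: "poly ((pderiv ^^ k) (L_hat m p M h i)) ?a = 0"
      "poly ((pderiv ^^ k) (L_hat m p M h i)) ?b = 0" if "k \<le> m" for k i
    using L_hat_ends[OF assms(1) that] by blast+
  have pick: "(\<Sum>l=0..m. w l * e l) = w k"
    if "k \<le> m" "\<And>l. l \<le> m \<Longrightarrow> e l = (if k = l then 1 else 0)" for w e :: "nat \<Rightarrow> real" and k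
  proof -
    have "(\<Sum>l=0..m. w l * e l) = (\<Sum>l=0..m. if k = l then w l else 0)"
      using that(2) by (intro sum.cong) auto
    then show ?thesis using that(1) by simp
  qed
  show ?thesis
    unfolding interpolates_def
  proof (intro conjI allI ballI impI)
    show "degree ((\<Sum>i=2..p - 2 * m. smult (f 0 (node m p M h i)) (L_hat m p M h i))
      + (\<Sum>l=0..m. smult (f l ?a) (A_hat m p M h l))
      + (\<Sum>l=0..m. smult (f l ?b) (B_hat m p M h l))) \<le> p"
      using assms(1) unfolding A B
      by (intro degree_add_le degree_sum_le order.trans[OF degree_smult_le] degree_L_hat degree_end_basis)
        auto
  next
    fix k assume k: "k \<le> m"
    show "poly ((pderiv ^^ k) ((\<Sum>i=2..p - 2 * m. smult (f 0 (node m p M h i)) (L_hat m p M h i))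
      + (\<Sum>l=0..m. smult (f l ?a) (A_hat m p M h l))
      + (\<Sum>l=0..m. smult (f l ?b) (B_hat m p M h l)))) ?a = f k ?a"
      unfolding higher_pderiv_add higher_pderiv_sum higher_pderiv_smult A B poly_add poly_sum poly_smult
      by (subst pick[OF k end_basis_end_coeffs[OF _ k ne(1) nodes(1)]])
        (simp_all add: L_ends[OF k] end_basis_opposite k)
    show "poly ((pderiv ^^ k) ((\<Sum>i=2..p - 2 * m. smult (f 0 (node m p M h i)) (L_hat m p M h i))
      + (\<Sum>l=0..m. smult (f l ?a) (A_hat m p M h l))
      + (\<Sum>l=0..m. smult (f l ?b) (B_hat m p M h l)))) ?b = f k ?b"
      unfolding higher_pderiv_add higher_pderiv_sum higher_pderiv_smult A B poly_add poly_sum poly_smult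
      by (subst pick[OF k end_basis_end_coeffs[OF _ k ne(2) nodes(2)]])
        (simp_all add: L_ends[OF k] end_basis_opposite k)
  next
    fix j assume j: "j \<in> {2..p - 2 * m}"
    have "(\<Sum>i=2..p - 2 * m. f 0 (node m p M h i) * poly (L_hat m p M h i) (node m p M h j))
        = (\<Sum>i=2..p - 2 * m. if i = j then f 0 (node m p M h i) else 0)"
      by (intro sum.cong refl) (simp add: L_hat_node[OF assms(2,1) _ j])
    also have "\<dots> = f 0 (node m p M h j)" using j by (simp add: sum.delta)
    finally show "poly ((\<Sum>i=2..p - 2 * m. smult (f 0 (node m p M h i)) (L_hat m p M h i))
      + (\<Sum>l=0..m. smult (f l ?a) (A_hat m p M h l))
      + (\<Sum>l=0..m. smult (f l ?b) (B_hat m p M h l))) (node m p M h j) = f 0 (node m p M h j)"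
      unfolding A B poly_add poly_sum poly_smult by (simp add: end_basis_node[OF j])
  qed
qed

section \<open>The error formula\<close>

text \<open>The segment from \<open>c\<close> to \<open>x\<close> lies in the open interval, where
  derivatives within the closed interval are ordinary two-sided ones, so the classical theorem with
  Lagrange remainder applies. It asks for distinct points, hence the separate case
  \<open>x = c\<close>.\<close>

lemma nderiv_within_Taylor:
  fixes a b c x :: real
  assumes "C_infinity_on {a..b} u" "c \<in> {a<..<b}" "x \<in> {a<..<b}" "n > 0"
  shows "\<exists>t\<in>{a..b}. u x = (\<Sum>k<n. nderiv_within {a..b} u k c / fact k * (x - c) ^ k)
    + nderiv_within {a..b} u n t / fact n * (x - c) ^ n"
proof (cases "x = c")
  case True
  have "(\<Sum>k<n. nderiv_within {a..b} u k c / fact k * (x - c) ^ k)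
      = (\<Sum>k<n. if k = 0 then u c else 0)"
    using True by (intro sum.cong) auto
  then show ?thesis using True assms by (intro bexI[of _ c]) auto
next
  case False
  have "DERIV (nderiv_within {a..b} u k) t :> nderiv_within {a..b} u (Suc k) t" if "t \<in> {a<..<b}" for k t
  proof -
    have "nderiv_within {a..b} u k differentiable (at t within {a..b})"
      using assms(1) that by (auto simp: C_infinity_on_def differentiable_on_def)
    then have "(nderiv_within {a..b} u k has_vector_derivative nderiv_within {a..b} u (Suc k) t)
        (at t within {a..b})"
      by (simp add: vector_derivative_works)
    moreover have "at t within {a..b} = at t"
      using that by (intro at_within_interior) simp
    ultimately show ?thesis by (simp add: has_real_derivative_iff_has_vector_derivative)
  qed
  then have "\<forall>k t. k < n \<and> min c x \<le> t \<and> t \<le> max c x \<longrightarrow>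
      DERIV (nderiv_within {a..b} u k) t :> nderiv_within {a..b} u (Suc k) t"
    using assms(2,3) by (auto simp: min_le_iff_disj le_max_iff_disj)
  then obtain t where t: "if x < c then x < t \<and> t < c else c < t \<and> t < x"
      "u x = (\<Sum>k<n. nderiv_within {a..b} u k c / fact k * (x - c) ^ k)
        + nderiv_within {a..b} u n t / fact n * (x - c) ^ n"
    using Taylor[of n "nderiv_within {a..b} u" u "min c x" "max c x" c x] assms(4) False by auto
  then show ?thesis using assms(2,3) by (intro bexI[of _ t]) (auto split: if_splits)
qed

text \<open>The terms of \<open>v\<close> of degree at most \<open>p\<close> stay as they are, and
  each higher power is reduced by \<open>Upsilon\<close> times its \<open>Psi\<close>. The result
  has degree at most \<open>p\<close> and keeps the data of \<open>v\<close>.\<close>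

lemma interpolates_taylor_poly:
  fixes m p s :: nat and M h :: real and S :: "real set" and u :: "real \<Rightarrow> real"
  assumes "2 * m + 1 \<le> p" "h > 0"
  defines "c k \<equiv> nderiv_within S u k M / fact k"
  defines "v \<equiv> taylor_poly S u M (p + s + 1)"
  shows "interpolates m p M h (\<lambda>i. poly ((pderiv ^^ i) v))
    (v - Upsilon m p M h * (\<Sum>i=0..s. smult (c (p + i + 1)) (Psi m p M h i)))"
proof (rule interpolates_minus_Upsilon_mult[OF assms(1,2)])
  let ?y = "[:-M, 1:]"
  have "v = (\<Sum>i\<le>p. smult (c i) (?y ^ i)) + (\<Sum>i=0..s. smult (c (p + i + 1)) (?y ^ (p + i + 1)))"
  proof -
    have "{..p + s + 1} = {..p} \<union> {p + 1..p + s + 1}" by auto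
    then have "v = (\<Sum>i\<le>p. smult (c i) (?y ^ i)) + (\<Sum>i=p + 1..p + s + 1. smult (c i) (?y ^ i))"
      unfolding v_def taylor_poly_def c_def[symmetric] by (simp only:) (intro sum.union_disjoint; auto)
    also have "(\<Sum>i=p + 1..p + s + 1. smult (c i) (?y ^ i))
        = (\<Sum>i=0..s. smult (c (p + i + 1)) (?y ^ (p + i + 1)))"
      by (rule sum.reindex_bij_witness[of _ "\<lambda>i. p + i + 1" "\<lambda>i. i - (p + 1)"]) auto
    finally show ?thesis .
  qed
  then have "v - Upsilon m p M h * (\<Sum>i=0..s. smult (c (p + i + 1)) (Psi m p M h i))
    = (\<Sum>i\<le>p. smult (c i) (?y ^ i))
      + (\<Sum>i=0..s. smult (c (p + i + 1)) (?y ^ (p + i + 1) - Upsilon m p M h * Psi_poly m p M h i))"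
    by (simp only: Psi_eq[OF assms(1,2)] sum_distrib_left mult_smult_right smult_diff_right
        sum_subtractf add_diff_eq)
  also have "degree \<dots> \<le> p"
    using degree_power_minus_Upsilon_mult_Psi_poly[OF assms(1,2)]
    by (intro degree_add_le degree_sum_le order.trans[OF degree_smult_le])
      (simp_all only: degree_linear_power finite_atMost finite_atLeastAtMost atMost_iff)
  finally show "degree (v - Upsilon m p M h * (\<Sum>i=0..s. smult (c (p + i + 1)) (Psi m p M h i))) \<le> p" .
qed

theorem theorem3p1:
  fixes m p s :: nat and M h :: real and u :: "real \<Rightarrow> real"
    and \<Delta> :: "real set" and v :: "real poly"
  assumes "p \<ge> 2 * m + 1" and "h > 0"
    and \<Delta>: "\<Delta> = {M - h / 2..M + h / 2}"
    and "C_infinity_on \<Delta> u"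
    and v: "v = taylor_poly \<Delta> u M (p + s + 1)"
  shows "(\<forall>x\<in>{M - h / 2<..<M + h / 2}. \<exists>xh\<in>\<Delta>.
            u x - poly (hermite_jacobi m p M h u) x =
              poly (Upsilon m p M h) x
                * (\<Sum>i=0..s. nderiv_within \<Delta> u (p + i + 1) M / fact (p + i + 1) * poly (Psi m p M h i) x)
              + nderiv_within \<Delta> u (p + s + 2) xh / fact (p + s + 2) * (x - M) ^ (p + s + 2)
              + (\<Sum>i=2..p - 2 * m.
                   (poly v (node m p M h i) - u (node m p M h i)) * poly (L_hat m p M h i) x)
              + (\<Sum>l=0..m.
                   (poly ((pderiv ^^ l) v) (node m p M h 1)
                      - nderiv_within \<Delta> u l (node m p M h 1)) * poly (A_hat m p M h l) x)
              + (\<Sum>l=0..m.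
                   (poly ((pderiv ^^ l) v) (node m p M h (p - 2 * m + 1))
                      - nderiv_within \<Delta> u l (node m p M h (p - 2 * m + 1))) * poly (B_hat m p M h l) x))
       \<and> (\<forall>i\<le>s.
            Upsilon m p M h dvd Psi_numerator m p M h i
          \<and> Psi m p M h i =
              (\<Sum>l=0..i div 2. smult (psi_coeff m p h i l) ([:-M, 1:] ^ (i - 2 * l))))"
proof (intro conjI ballI allI impI)
  note ph = assms(1,2)
  fix x assume x: "x \<in> {M - h / 2<..<M + h / 2}"
  let ?L = "\<lambda>i. poly (L_hat m p M h i) x" and ?A = "\<lambda>l. poly (A_hat m p M h l) x"
    and ?B = "\<lambda>l. poly (B_hat m p M h l) x" and ?du = "nderiv_within \<Delta> u"
    and ?dv = "\<lambda>l. poly ((pderiv ^^ l) v)"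
  have "M \<in> {M - h / 2<..<M + h / 2}" using ph by simp
  from nderiv_within_Taylor[OF assms(4)[unfolded \<Delta>] this x, of "p + s + 2"]
  obtain xh where xh: "xh \<in> \<Delta>"
      "u x = (\<Sum>k<p + s + 2. ?du k M / fact k * (x - M) ^ k)
        + ?du (p + s + 2) xh / fact (p + s + 2) * (x - M) ^ (p + s + 2)"
    unfolding \<Delta> by auto
  have "{..<p + s + 2} = {..p + s + 1}" by auto
  then have ux: "u x = poly v x + ?du (p + s + 2) xh / fact (p + s + 2) * (x - M) ^ (p + s + 2)"
    using xh(2) by (simp add: v taylor_poly_def poly_sum del: fact_Suc power_Suc)
  have "hermite_jacobi m p M h u =
    ((\<Sum>i=2..p - 2 * m. smult (?du 0 (node m p M h i)) (L_hat m p M h i))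
      + (\<Sum>l=0..m. smult (?du l (M - h / 2)) (A_hat m p M h l))
      + (\<Sum>l=0..m. smult (?du l (M + h / 2)) (B_hat m p M h l)))"
    unfolding \<Delta> by (intro hermite_jacobi_eqI interpolates_basis_sum ph)
  then have W: "poly (hermite_jacobi m p M h u) x =
      (\<Sum>i=2..p - 2 * m. u (node m p M h i) * ?L i)
      + (\<Sum>l=0..m. ?du l (node m p M h 1) * ?A l)
      + (\<Sum>l=0..m. ?du l (node m p M h (p - 2 * m + 1)) * ?B l)"
    unfolding node_1 node_end[OF ph(1)] by (simp add: poly_sum)
  \<comment> \<open>The interpolant of \<open>v\<close> is described twice, as a remainder modulo
    \<open>Upsilon\<close> and in the Lagrange basis; uniqueness equates the two.\<close>
  have "v - Upsilon m p M h * (\<Sum>i=0..s. smult (?du (p + i + 1) M / fact (p + i + 1)) (Psi m p M h i)) =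
    ((\<Sum>i=2..p - 2 * m. smult (?dv 0 (node m p M h i)) (L_hat m p M h i))
      + (\<Sum>l=0..m. smult (?dv l (M - h / 2)) (A_hat m p M h l))
      + (\<Sum>l=0..m. smult (?dv l (M + h / 2)) (B_hat m p M h l)))"
    unfolding v by (rule interpolates_unique[OF ph interpolates_taylor_poly[OF ph] interpolates_basis_sum[OF ph]])
  from arg_cong[OF this, of "\<lambda>q. poly q x"]
  have V: "poly v x - poly (Upsilon m p M h) x
        * (\<Sum>i=0..s. ?du (p + i + 1) M / fact (p + i + 1) * poly (Psi m p M h i) x) =
      (\<Sum>i=2..p - 2 * m. poly v (node m p M h i) * ?L i)
      + (\<Sum>l=0..m. ?dv l (node m p M h 1) * ?A l)
      + (\<Sum>l=0..m. ?dv l (node m p M h (p - 2 * m + 1)) * ?B l)"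
    unfolding node_1 node_end[OF ph(1)] by (simp add: poly_sum del: fact_Suc)
  \<comment> \<open>The final bookkeeping is linear; stated over plain reals it keeps the sums
    atomic, with \<open>q\<close> for the value of \<open>v\<close> and \<open>T\<close> for the
    Taylor remainder.\<close>
  have combine: "U - w = Y + T + (a' - a) + (b' - b) + (c' - c)"
    if "U = q + T" "w = a + b + c" "q - Y = a' + b' + c'" for U w Y T q a a' b b' c c' :: real
    using that by simp
  show "\<exists>xh\<in>\<Delta>.
            u x - poly (hermite_jacobi m p M h u) x =
              poly (Upsilon m p M h) x
                * (\<Sum>i=0..s. ?du (p + i + 1) M / fact (p + i + 1) * poly (Psi m p M h i) x)
              + ?du (p + s + 2) xh / fact (p + s + 2) * (x - M) ^ (p + s + 2)
              + (\<Sum>i=2..p - 2 * m. (poly v (node m p M h i) - u (node m p M h i)) * ?L i)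
              + (\<Sum>l=0..m. (?dv l (node m p M h 1) - ?du l (node m p M h 1)) * ?A l)
              + (\<Sum>l=0..m. (?dv l (node m p M h (p - 2 * m + 1))
                      - ?du l (node m p M h (p - 2 * m + 1))) * ?B l)"
    unfolding left_diff_distrib sum_subtractf by (rule bexI[OF _ xh(1)]) (rule combine[OF ux W V])
next
  fix i
  show "Upsilon m p M h dvd Psi_numerator m p M h i"
    by (simp add: Psi_numerator_eq[OF assms(1,2)])
  show "Psi m p M h i = (\<Sum>l=0..i div 2. smult (psi_coeff m p h i l) ([:-M, 1:] ^ (i - 2 * l)))"
    unfolding Psi_eq[OF assms(1,2)] Psi_poly_def ..
qed

end
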